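(* Let $S=(1,2,2,2,\ldots)$, i.e. $a_1=1$ and $a_i=2$ for all $i\geq 2$, and let $n\geq 3$. Then $$\chi_S''(P_n)=\begin{cases}4, & n=3,\\ 5, & n\geq 4.\end{cases}$$
   Context: $P_n$ is the path on $n$ vertices. For vertices $u,v$ of a graph $G$, $d(u,v)$ is the usual shortest-path distance. For a vertex $u$ and an edge $ab$, $d(u,ab)=d(ab,u)=\min\{d(u,a),d(u,b)\}+1$. For two distinct edges $ab,cd$, $d(ab,cd)=\min\{d(a,c),d(a,d),d(b,c),d(b,d)\}+1$. For a non-decreasing infinite sequence $S=(a_1,a_2,\ldots)$ of positive integers, an $S$-packing total coloring of $G$ using $k$ colors is a map $c:V(G)\cup E(G)\to\{1,\ldots,k\}$ such that any two distinct elements $A,B\in V(G)\cup E(G)$ with $c(A)=c(B)=i$ satisfy $d(A,B)>a_i$. The $S$-packing total chromatic number $\chi_S''(G)$ is the smallest $k$ for which one exists. *)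

theory Defs
  imports "HOL-Library.Extended_Nat"
begin

text \<open>Undirected simple graphs; every edge is the two-element set of its endpoints.\<close>

record 'a graph =
  verts :: "'a set"
  edges :: "'a set set"

definition path_between :: "'a graph \<Rightarrow> 'a \<Rightarrow> 'a list \<Rightarrow> 'a \<Rightarrow> bool" where
  "path_between G u xs v \<longleftrightarrow>
     xs \<noteq> [] \<and> hd xs = u \<and> last xs = v \<and> distinct xs \<and> set xs \<subseteq> verts G \<and>
     successively (\<lambda>x y. {x, y} \<in> edges G) xs"

text \<open>A list of \<open>m + 1\<close> vertices is a path of length \<open>m\<close>. The distance is \<open>\<infinity>\<close> if the
  vertices lie in different components.\<close>

definition vdist :: "'a graph \<Rightarrow> 'a \<Rightarrow> 'a \<Rightarrow> enat" where
  "vdist G u v = (INF xs \<in> {xs. path_between G u xs v}. enat (length xs - 1))"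

datatype 'a element = Vertex 'a | Edge "'a set"

definition elements :: "'a graph \<Rightarrow> 'a element set" where
  "elements G = Vertex ` verts G \<union> Edge ` edges G"

text \<open>Meant for distinct elements only: \<open>edist G (Edge e) (Edge e)\<close> is 1, not 0.\<close>

fun edist :: "'a graph \<Rightarrow> 'a element \<Rightarrow> 'a element \<Rightarrow> enat" where
  "edist G (Vertex u) (Vertex v) = vdist G u v"
| "edist G (Vertex u) (Edge e) = (INF a \<in> e. vdist G u a) + 1"
| "edist G (Edge e) (Vertex u) = (INF a \<in> e. vdist G u a) + 1"
| "edist G (Edge e) (Edge f) = (INF a \<in> e. INF b \<in> f. vdist G a b) + 1"

text \<open>A sequence \<open>S = (a\<^sub>1, a\<^sub>2, \<dots>)\<close> is a function with \<open>S i = a\<^sub>i\<close> for \<open>i \<ge> 1\<close>;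
  the value \<open>S 0\<close> is never used.\<close>

definition packing_total_coloring ::
    "(nat \<Rightarrow> nat) \<Rightarrow> 'a graph \<Rightarrow> nat \<Rightarrow> ('a element \<Rightarrow> nat) \<Rightarrow> bool" where
  "packing_total_coloring S G k c \<longleftrightarrow>
     c ` elements G \<subseteq> {1..k} \<and>
     (\<forall>A \<in> elements G. \<forall>B \<in> elements G.
        A \<noteq> B \<longrightarrow> c A = c B \<longrightarrow> edist G A B > enat (S (c A)))"

text \<open>The value is \<open>\<infinity>\<close> if there is no such coloring with finitely many colors.\<close>

definition packing_total_chromatic_number :: "(nat \<Rightarrow> nat) \<Rightarrow> 'a graph \<Rightarrow> enat" where
  "packing_total_chromatic_number S G =
     (INF k \<in> {k. \<exists>c. packing_total_coloring S G k c}. enat k)"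

definition path_graph :: "nat \<Rightarrow> nat graph" where
  "path_graph n = \<lparr>verts = {1..n}, edges = {{i, i + 1} | i. 1 \<le> i \<and> i < n}\<rparr>"

end

theory Submission
  imports Defs
begin

text \<open>
  List the elements of the path \<open>P\<^sub>n\<close> in the order in which one meets them when walking
  along it: vertex, edge, vertex, and so on. Write \<open>2 i\<close> for the place of the vertex \<open>i\<close> and
  \<open>2 i + 1\<close> for the place of the edge between \<open>i\<close> and \<open>i + 1\<close>, so that the places are
  \<open>2, \<dots>, 2 n\<close>. Two elements whose places differ by \<open>d > 0\<close> are at distance
  \<open>\<lceil>d / 2\<rceil>\<close> (\<open>edist_element_at\<close>), hence \<open>S\<close>-packing total colorings of \<open>P\<^sub>n\<close> are
  the same as colorings of the integers \<open>2, \<dots>, 2 n\<close> in which two occurrences of a color \<open>i\<close>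
  differ by more than \<open>2 S i\<close> (\<open>packing_total_coloring_path_graph_iff\<close>). For the sequence
  \<open>1, 2, 2, \<dots>\<close> the occurrences of color 1 have to be at least 3 apart and those of every
  other color at least 5 apart.

  Coloring the integers periodically with five colors is therefore always possible, and for
  the five places of \<open>P\<^sub>3\<close> the pattern \<open>1, 2, 3, 1, 4\<close> saves one color.

  For the lower bounds consider five consecutive places. Only color 1 can be repeated there,
  and only once, with the second occurrence at one of the last two places. So at least four
  colors occur, and if there are no more than four, then color 1 does occur at one of the last
  two places (\<open>colors_in_five_places\<close>). If \<open>n \<ge> 4\<close>, there are seven places, which is enough
  room to refute the latter possibility: having color 1 at the place \<open>y\<close>, look at the
  five places centered at \<open>y\<close>; they would need color 1 at \<open>y + 1\<close> or \<open>y + 2\<close>, too close to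
  \<open>y\<close>.
\<close>

section \<open>Distances in a path\<close>

text \<open>Distances are written as \<open>(u - v) + (v - u)\<close>: with truncated subtraction on the natural
  numbers one of the two summands is 0 and the other one is the absolute difference.\<close>

text \<open>Neighbors in the path differ by 1, so a walk has to make at least as many steps as
  the difference of its ends demands.\<close>

lemma path_graph_walk_length:
  assumes "xs \<noteq> []" "successively (\<lambda>x y. {x, y} \<in> edges (path_graph n)) xs"
  shows "(hd xs - last xs) + (last xs - hd xs) \<le> length xs - 1"
  using assms
proof (induction xs)
  case (Cons x xs)
  show ?case
  proof (cases xs)
    case (Cons y ys)
    then have "{x, y} \<in> edges (path_graph n)"
      and "successively (\<lambda>x y. {x, y} \<in> edges (path_graph n)) xs"
      using Cons.prems by auto
    moreover from this(1) have "x = y + 1 \<or> y = x + 1"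
      by (auto simp: path_graph_def doubleton_eq_iff)
    ultimately show ?thesis
      using Cons.IH Cons by auto
  qed auto
qed auto

lemma path_between_upt:
  assumes "1 \<le> u" "u \<le> v" "v \<le> n"
  shows "path_between (path_graph n) u [u..<Suc v] v"
    and "path_between (path_graph n) v (rev [u..<Suc v]) u"
proof -
  have "successively (\<lambda>x y. {x, y} \<in> edges (path_graph n)) [u..<Suc v]"
    unfolding successively_conv_nth using assms
    by (auto simp: path_graph_def simp del: upt_Suc)
  moreover from this have
    "successively (\<lambda>x y. {x, y} \<in> edges (path_graph n)) (rev [u..<Suc v])"
    unfolding successively_rev by (simp add: insert_commute del: upt_Suc)
  moreover have "set [u..<Suc v] \<subseteq> verts (path_graph n)"
    using assms by (auto simp: path_graph_def)
  moreover have "hd [u..<Suc v] = u" "last [u..<Suc v] = v" "[u..<Suc v] \<noteq> []"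
    using assms by (auto simp: hd_append)
  ultimately show "path_between (path_graph n) u [u..<Suc v] v"
    and "path_between (path_graph n) v (rev [u..<Suc v]) u"
    unfolding path_between_def by (auto simp: hd_rev last_rev simp del: upt_Suc)
qed

lemma vdist_path_graph:
  assumes "u \<in> {1..n}" "v \<in> {1..n}"
  shows "vdist (path_graph n) u v = enat ((u - v) + (v - u))"
proof (rule antisym)
  have "\<exists>xs. path_between (path_graph n) u xs v \<and> length xs - 1 = (u - v) + (v - u)"
  proof (cases "u \<le> v")
    case True
    then show ?thesis
      using path_between_upt(1)[of u v n] assms by (intro exI[of _ "[u..<Suc v]"]) auto
  next
    case False
    then show ?thesis
      using path_between_upt(2)[of v u n] assms by (intro exI[of _ "rev [v..<Suc u]"]) auto
  qed
  then show "vdist (path_graph n) u v \<le> enat ((u - v) + (v - u))"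
    unfolding vdist_def by (auto intro: INF_lower2)
  show "enat ((u - v) + (v - u)) \<le> vdist (path_graph n) u v"
    unfolding vdist_def
  proof (rule INF_greatest)
    fix xs assume "xs \<in> {xs. path_between (path_graph n) u xs v}"
    then show "enat ((u - v) + (v - u)) \<le> enat (length xs - 1)"
      using path_graph_walk_length[of xs n] by (auto simp: path_between_def)
  qed
qed

section \<open>The elements of a path as consecutive integers\<close>

definition element_at :: "nat \<Rightarrow> nat element" where
  "element_at p = (if even p then Vertex (p div 2) else Edge {p div 2, p div 2 + 1})"

lemma element_at_simps [simp]:
  "element_at (2 * i) = Vertex i" "element_at (Suc (2 * i)) = Edge {i, Suc i}"
  by (simp_all add: element_at_def)

lemma inj_element_at: "inj element_at"
proof (rule injI)
  fix p q assume "element_at p = element_at q"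
  then show "p = q"
    by (cases "even p"; cases "even q") (auto elim!: evenE oddE simp: doubleton_eq_iff)
qed

lemma elements_path_graph: "elements (path_graph n) = element_at ` {2..2 * n}"
proof
  have "Vertex i \<in> element_at ` {2..2 * n}" if "1 \<le> i" "i \<le> n" for i
    using that by (intro image_eqI[of _ _ "2 * i"]) auto
  moreover have "Edge {i, Suc i} \<in> element_at ` {2..2 * n}" if "1 \<le> i" "i < n" for i
    using that by (intro image_eqI[of _ _ "Suc (2 * i)"]) auto
  ultimately show "elements (path_graph n) \<subseteq> element_at ` {2..2 * n}"
    by (auto simp: elements_def path_graph_def)
  have "element_at p \<in> elements (path_graph n)" if "p \<in> {2..2 * n}" for p
  proof (cases "even p")
    case True
    with that show ?thesis by (auto elim!: evenE simp: elements_def path_graph_def)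
  next
    case False
    then obtain i where "p = Suc (2 * i)" by (auto elim: oddE)
    moreover from this that have "1 \<le> i" "i < n" by auto
    ultimately show ?thesis by (auto simp: elements_def path_graph_def)
  qed
  then show "element_at ` {2..2 * n} \<subseteq> elements (path_graph n)"
    by auto
qed

text \<open>The added 1 in the distances that involve edges is exactly what turns the halved
  difference of the places into the rounded-up one, whatever the kinds of the two elements
  are.\<close>

lemma edist_element_at:
  assumes "p \<in> {2..2 * n}" "q \<in> {2..2 * n}" "p \<noteq> q"
  shows "edist (path_graph n) (element_at p) (element_at q) =
    enat (((p - q) + (q - p) + 1) div 2)"
proof -
  note [simp] = vdist_path_graph inf_min one_enat_def
  consider (vv) i j where "p = 2 * i" "q = 2 * j" | (ve) i j where "p = 2 * i" "q = Suc (2 * j)"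
    | (ev) i j where "p = Suc (2 * i)" "q = 2 * j"
    | (ee) i j where "p = Suc (2 * i)" "q = Suc (2 * j)"
    by (metis evenE oddE Suc_eq_plus1)
  then show ?thesis
  proof cases
    case vv
    with assms show ?thesis by (cases "i < j") auto
  next
    case ve
    with assms have "1 \<le> i" "i \<le> n" "1 \<le> j" "Suc j \<le> n" by auto
    with ve show ?thesis by (cases "i < j") (simp_all add: min_def, arith+)
  next
    case ev
    with assms have "1 \<le> i" "Suc i \<le> n" "1 \<le> j" "j \<le> n" by auto
    with ev show ?thesis by (cases "i < j") (simp_all add: min_def, arith+)
  next
    case ee
    with assms have "1 \<le> i" "Suc i \<le> n" "1 \<le> j" "Suc j \<le> n" "i \<noteq> j" by auto
    with ee show ?thesis by (cases "i < j") (simp_all add: min_def, arith+)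
  qed
qed

lemma packing_total_coloring_path_graph_iff:
  "packing_total_coloring S (path_graph n) k c \<longleftrightarrow>
     (\<forall>p \<in> {2..2 * n}. c (element_at p) \<in> {1..k}) \<and>
     (\<forall>p \<in> {2..2 * n}. \<forall>q \<in> {2..2 * n}. p < q \<longrightarrow> c (element_at p) = c (element_at q) \<longrightarrow>
        2 * S (c (element_at p)) < q - p)"
    (is "_ \<longleftrightarrow> ?range \<and> ?gaps")
proof -
  have half: "s < Suc ((p - q) + (q - p)) div 2 \<longleftrightarrow> 2 * s < (p - q) + (q - p)" for s p q :: nat
    by arith
  have "packing_total_coloring S (path_graph n) k c \<longleftrightarrow> ?range \<and>
     (\<forall>p \<in> {2..2 * n}. \<forall>q \<in> {2..2 * n}. p \<noteq> q \<longrightarrow> c (element_at p) = c (element_at q) \<longrightarrow>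
        2 * S (c (element_at p)) < (p - q) + (q - p))" (is "_ \<longleftrightarrow> _ \<and> ?gaps'")
    unfolding packing_total_coloring_def elements_path_graph
    by (simp add: image_subset_iff inj_eq[OF inj_element_at] edist_element_at half
        cong: ball_cong del: atLeastAtMost_iff)
  also have "?gaps' \<longleftrightarrow> ?gaps"
  proof
    assume gaps: ?gaps
    show ?gaps'
    proof (intro ballI impI)
      fix p q
      assume "p \<in> {2..2 * n}" "q \<in> {2..2 * n}" "p \<noteq> q" "c (element_at p) = c (element_at q)"
      then show "2 * S (c (element_at p)) < (p - q) + (q - p)"
        using gaps[rule_format, of p q] gaps[rule_format, of q p] by (cases "p < q") auto
    qed
  qed fastforce
  finally show ?thesis .
qed

text \<open>Any coloring of the places is realized by a coloring of the elements, so that upper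
  bounds can be given by formulas in the places.\<close>

lemma packing_total_chromatic_number_path_graph_le:
  fixes f :: "nat \<Rightarrow> nat"
  assumes "\<And>p. p \<in> {2..2 * n} \<Longrightarrow> f p \<in> {1..k}"
    and "\<And>p q. \<lbrakk>p \<in> {2..2 * n}; q \<in> {2..2 * n}; p < q; f p = f q\<rbrakk> \<Longrightarrow> 2 * S (f p) < q - p"
  shows "packing_total_chromatic_number S (path_graph n) \<le> enat k"
proof -
  have "packing_total_coloring S (path_graph n) k (f \<circ> inv element_at)"
    unfolding packing_total_coloring_path_graph_iff using assms
    by (simp add: inv_f_f[OF inj_element_at])
  then show ?thesis
    unfolding packing_total_chromatic_number_def by (auto intro: INF_lower)
qed

section \<open>Counting colors in five consecutive places\<close>

text \<open>Removing the color 1 from the last two places removes at most one place, and the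
  remaining places have different colors.\<close>

lemma colors_in_five_places:
  fixes f :: "nat \<Rightarrow> nat"
  assumes range: "\<And>p. p \<in> {a..a + 4} \<Longrightarrow> f p \<in> {1..k}"
    and one: "\<And>p q. \<lbrakk>p \<in> {a..a + 4}; q \<in> {a..a + 4}; p < q; f p = f q; f p = 1\<rbrakk> \<Longrightarrow> 3 \<le> q - p"
    and other: "\<And>p q. \<lbrakk>p \<in> {a..a + 4}; q \<in> {a..a + 4}; p < q; f p = f q; f p \<noteq> 1\<rbrakk> \<Longrightarrow> 5 \<le> q - p"
  shows "4 \<le> k" and "k \<le> 4 \<Longrightarrow> f (a + 3) = 1 \<or> f (a + 4) = 1"
proof -
  define R where "R = {p \<in> {a + 3, a + 4}. f p = 1}"
  have "R \<subseteq> {a + 3} \<or> R \<subseteq> {a + 4}"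
    using one[of "a + 3" "a + 4"] by (auto simp: R_def)
  then have card_R: "card R \<le> 1"
    by (auto dest!: subset_singletonD)
  have less: "f p \<noteq> f q" if "p \<in> {a..a + 4} - R" "q \<in> {a..a + 4} - R" "p < q" for p q
  proof
    assume "f p = f q"
    show False
    proof (cases "f p = 1")
      case True
      with that \<open>f p = f q\<close> have "q \<noteq> a + 3" "q \<noteq> a + 4"
        by (auto simp: R_def)
      with one[of p q] that True \<open>f p = f q\<close> show False by auto
    next
      case False
      with other[of p q] that \<open>f p = f q\<close> show False by auto
    qed
  qed
  have "inj_on f ({a..a + 4} - R)"
    by (rule inj_onI) (metis less linorder_neqE_nat)
  then have "card ({a..a + 4} - R) \<le> card {1..k}"
    using range by (intro card_inj_on_le) auto
  moreover have "card ({a..a + 4} - R) = 5 - card R"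
    by (subst card_Diff_subset) (auto simp: R_def)
  ultimately have k: "5 \<le> k + card R"
    by simp
  with card_R show "4 \<le> k" by simp
  show "f (a + 3) = 1 \<or> f (a + 4) = 1" if "k \<le> 4"
  proof (rule ccontr)
    assume "\<not> ?thesis"
    then have "R = {}" by (auto simp: R_def)
    with k that show False by simp
  qed
qed

text \<open>The second bound uses seven consecutive places: the five places at the beginning force
  color 1 onto a place from which there is still room for two more places.\<close>

lemma packing_total_coloring_path_graph_bounds:
  assumes S: "S 1 = 1" "\<And>i. i \<ge> 2 \<Longrightarrow> S i = 2"
    and "packing_total_coloring S (path_graph n) k c"
  shows "n \<ge> 3 \<Longrightarrow> 4 \<le> k" and "n \<ge> 4 \<Longrightarrow> 5 \<le> k"
proof -
  define f where "f p = c (element_at p)" for p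
  have range: "f p \<in> {1..k}" if "p \<in> {2..2 * n}" for p
    using assms(3) that by (auto simp: packing_total_coloring_path_graph_iff f_def)
  have gap: "2 * S (f p) < q - p" if "p \<in> {2..2 * n}" "q \<in> {2..2 * n}" "p < q" "f p = f q" for p q
    using assms(3) that unfolding packing_total_coloring_path_graph_iff f_def by blast
  have one: "3 \<le> q - p"
    if "p \<in> {2..2 * n}" "q \<in> {2..2 * n}" "p < q" "f p = f q" "f p = 1" for p q
    using gap[of p q] that S(1) by simp
  have other: "5 \<le> q - p"
    if "p \<in> {2..2 * n}" "q \<in> {2..2 * n}" "p < q" "f p = f q" "f p \<noteq> 1" for p q
    using gap[of p q] range[of p] that S(2)[of "f p"] by simp
  have four: "4 \<le> k" if "2 \<le> a" "a + 4 \<le> 2 * n" for a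
    by (rule colors_in_five_places(1)[of a f k]) (use that range one other in auto)
  have last_two: "f (a + 3) = 1 \<or> f (a + 4) = 1" if "2 \<le> a" "a + 4 \<le> 2 * n" "k \<le> 4" for a
    by (rule colors_in_five_places(2)[of a f k]) (use that range one other in auto)
  show "4 \<le> k" if "n \<ge> 3"
    using four[of 2] that by simp
  show "5 \<le> k" if "n \<ge> 4"
  proof (rule ccontr)
    assume "\<not> 5 \<le> k"
    then have k: "k \<le> 4" by simp
    with last_two[of 2] that have "f 5 = 1 \<or> f 6 = 1"
      by simp
    then obtain y where y: "y \<in> {5, 6}" "f y = 1"
      by blast
    \<comment> \<open>the five places centered at \<open>y\<close>, whose last two are \<open>y + 1\<close> and \<open>y + 2\<close>\<close>
    have "f (y - 2 + 3) = 1 \<or> f (y - 2 + 4) = 1"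
      using last_two[of "y - 2"] y(1) that k by auto
    with y(1) have "f (y + 1) = 1 \<or> f (y + 2) = 1"
      by auto
    then obtain z where z: "z \<in> {y + 1, y + 2}" "f z = 1"
      by blast
    then show False
      using one[of y z] y that by auto
  qed
qed

theorem proposition15:
  fixes S :: "nat \<Rightarrow> nat" and n :: nat
  assumes "S 1 = 1" and "\<And>i. i \<ge> 2 \<Longrightarrow> S i = 2"
    and "n \<ge> 3"
  shows "packing_total_chromatic_number S (path_graph n) = (if n = 3 then 4 else 5)"
proof (rule antisym)
  show "packing_total_chromatic_number S (path_graph n) \<le> (if n = 3 then 4 else 5)"
  proof (cases "n = 3")
    case True
    \<comment> \<open>the pattern \<open>1, 2, 3, 1, 4\<close> on the places \<open>2, \<dots>, 6\<close>\<close>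
    define f :: "nat \<Rightarrow> nat" where "f p = (if p = 5 then 1 else if p = 6 then 4 else p - 1)" for p
    have "packing_total_chromatic_number S (path_graph n) \<le> enat 4"
    proof (rule packing_total_chromatic_number_path_graph_le[where f = f])
      fix p q
      assume "p \<in> {2..2 * n}" "q \<in> {2..2 * n}" "p < q" "f p = f q"
      with True have "p = 2" "q = 5"
        by (auto simp: f_def split: if_splits)
      with assms(1) show "2 * S (f p) < q - p"
        by (simp add: f_def)
    qed (use True in \<open>auto simp: f_def\<close>)
    with True show ?thesis by (simp add: numeral_eq_enat)
  next
    case False
    have S_le: "S i \<le> 2" if "i \<ge> 1" for i
      using assms(1) assms(2)[of i] that by (cases "i = 1") auto
    have "packing_total_chromatic_number S (path_graph n) \<le> enat 5"
    proof (rule packing_total_chromatic_number_path_graph_le[where f = "\<lambda>p. p mod 5 + 1"])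
      fix p q :: nat
      assume "p < q" "p mod 5 + 1 = q mod 5 + 1"
      then have "5 dvd q - p" using mod_eq_dvd_iff_nat[of p q 5] by simp
      with \<open>p < q\<close> have "5 \<le> q - p" by (simp add: dvd_imp_le)
      with S_le[of "p mod 5 + 1"] show "2 * S (p mod 5 + 1) < q - p" by simp
    qed (auto simp: Suc_le_eq)
    with False show ?thesis by (simp add: numeral_eq_enat)
  qed
  show "(if n = 3 then 4 else 5) \<le> packing_total_chromatic_number S (path_graph n)"
    unfolding packing_total_chromatic_number_def
  proof (rule INF_greatest)
    fix k assume "k \<in> {k. \<exists>c. packing_total_coloring S (path_graph n) k c}"
    then show "(if n = 3 then 4 else 5) \<le> enat k"
      using packing_total_coloring_path_graph_bounds[of S n k] assms
      by (auto simp: numeral_eq_enat)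
  qed
qed

end
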